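(* Fix a quantile level $\tau\in(0,1)$. For each sample size $n$ let $Y_1,\dots,Y_n$ follow the piecewise constant model with $K^*\in\mathbb{N}$ change-points $1<t_1^*<\dots<t_{K^*}^*<n$, phase values $\mu_1^*,\dots,\mu_{K^*+1}^*$ satisfying $\mu_k^*\neq\mu_{k+1}^*$ for $k=1,\dots,K^*$, and errors $\varepsilon_t$, and let $\widehat{\mathcal A}_n=\{\widehat t_1<\dots<\widehat t_{|\widehat{\mathcal A}_n|}\}$ be the set of change-point locations estimated by the quantile LASSO with regularization parameter $\lambda_n>0$ (model and estimator as defined in the context). Assume: (i) the values $\mu_k^*\in\mathbb{R}$, $k=1,\dots,K^*+1$, do not depend on $n$; (ii) the errors $\varepsilon_i$ are i.i.d. with an absolutely continuous distribution function $F$ such that $\mathbb{P}[\varepsilon_i<0]=\tau$, whose density $f$ satisfies $f(x)>0$ for all $x\in\mathbb{R}$ and is continuously differentiable with $|f'(x)|<\infty$; (iii) $I_{\min}^*:=\min_{1\le k\le K^*}(t_{k+1}^*-t_k^* )\ge n\delta_n$ for a decreasing positive sequence $(\delta_n)$ with $\delta_n\to0$ as $n\to\infty$; (iv) $\lambda_n/\delta_n\to0$ as $n\to\infty$; (v) $K^*$ is fixed and does not depend on $n$; (vi) $\lambda_n=C(n^{-1}\log n)^{1/2}$ for some constant $C>0$; (vii) $t_k^*/n\to\tau_k^*$ as $n\to\infty$ for $k=1,\dots,K^*$, where $0<\tau_1^*<\dots<\tau_{K^*}^*<1$ are fixed. Suppose that $|\widehat{\mathcal A}_n|=K^*$. Then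 $$\mathbb{P}\Big[\max_{1\le k\le K^*}|\widehat t_k-t_k^*|\ge n\delta_n\Big]\to0\qquad\text{as } n\to\infty.$$
   Context: Model. With the conventions $t_0^*=1$ and $t_{K^*+1}^*=n+1$, the observations are $Y_t=\mu_k^*+\varepsilon_t$ for $t_{k-1}^*\le t\le t_k^*-1$, $k=1,\dots,K^*+1$ (so $t=1,\dots,n$). The change-point locations $t_k^*$ may depend on $n$. Estimator. Let $\rho_\tau(v)=v\,(\tau-\mathbf{1}\{v<0\})$ for $v\in\mathbb{R}$. Let $\mathbb{X}_n$ be the $n\times n$ lower triangular matrix whose entries on and below the diagonal are all equal to $1$ (and $0$ above), so that $(\mathbb{X}_n\beta)_i=\sum_{j=1}^i\beta_j$. The quantile LASSO estimator is a solution $$\widehat{\beta}^n=(\widehat\beta_1,\dots,\widehat\beta_n)^\top\in\operatorname*{arg\,min}_{\beta\in\mathbb{R}^n}\Big[\sum_{i=1}^n\rho_\tau\big(Y_i-(\mathbb{X}_n\beta)_i\big)+n\lambda_n\sum_{i=2}^n|\beta_i|\Big].$$ The set of estimated change-point locations is $\widehat{\mathcal A}_n=\{i\in\{2,\dots,n\}:\widehat\beta_i\neq0\}=\{\widehat t_1,\dots,\widehat t_{|\widehat{\mathcal A}_n|}\}$, with $\widehat t_1<\dots<\widehat t_{|\widehat{\mathcal A}_n|}$. *)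

theory Defs
  imports "HOL-Probability.Probability"
begin

definition quantile_loss :: "real \<Rightarrow> real \<Rightarrow> real" where
  "quantile_loss \<tau> v = v * (\<tau> - (if v < 0 then 1 else 0))"

text \<open>
  Vectors in \<open>\<real>\<^sup>n\<close> are functions of type \<^typ>\<open>nat \<Rightarrow> real\<close> whose entries are read
  at the indices \<open>1, \<dots>, n\<close> only. The sample size must be a term, not a type, because the statement
  takes the limit in \<open>n\<close>.
\<close>

definition design_matrix :: "nat \<Rightarrow> nat \<Rightarrow> real" where
  "design_matrix i j = (if j \<le> i then 1 else 0)"

definition design_apply :: "nat \<Rightarrow> (nat \<Rightarrow> real) \<Rightarrow> nat \<Rightarrow> real" where
  "design_apply n \<beta> i = (\<Sum>j = 1..n. design_matrix i j * \<beta> j)"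

definition qlasso_objective ::
  "real \<Rightarrow> nat \<Rightarrow> real \<Rightarrow> (nat \<Rightarrow> real) \<Rightarrow> (nat \<Rightarrow> real) \<Rightarrow> real" where
  "qlasso_objective \<tau> n l y \<beta> =
     (\<Sum>i = 1..n. quantile_loss \<tau> (y i - design_apply n \<beta> i)) + real n * l * (\<Sum>i = 2..n. \<bar>\<beta> i\<bar>)"

text \<open>
  The minimiser need not be unique. Entries outside \<open>1, \<dots>, n\<close> do not enter the objective, so
  minimising over all functions is minimising over \<open>\<real>\<^sup>n\<close>.
\<close>

definition qlasso_solution ::
  "real \<Rightarrow> nat \<Rightarrow> real \<Rightarrow> (nat \<Rightarrow> real) \<Rightarrow> (nat \<Rightarrow> real) \<Rightarrow> bool" where
  "qlasso_solution \<tau> n l y \<beta> \<longleftrightarrow> is_arg_min (qlasso_objective \<tau> n l y) (\<lambda>_. True) \<beta>"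

definition est_changepoints :: "nat \<Rightarrow> (nat \<Rightarrow> real) \<Rightarrow> nat set" where
  "est_changepoints n \<beta> = {i \<in> {2..n}. \<beta> i \<noteq> 0}"

text \<open>
  The \<open>k\<close>-th smallest estimated change-point, counting from \<open>k = 1\<close>; it is meaningful only for
  \<open>k\<close> up to the number of estimated change-points.
\<close>

definition est_changepoint :: "nat \<Rightarrow> (nat \<Rightarrow> real) \<Rightarrow> nat \<Rightarrow> nat" where
  "est_changepoint n \<beta> k = sorted_list_of_set (est_changepoints n \<beta>) ! (k - 1)"

end

theory Submission
  imports Defs "HOL-Real_Asymp.Real_Asymp"
begin

text \<open>
  The penalty is cheap at the scale \<open>n \<delta>\<^sub>n\<close>, and this forces the fit to break near every
  true change-point. Suppose that no change-point is estimated within distance \<open>n \<delta>\<^sub>n\<close>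
  of \<open>t\<^sub>k\<^sup>*\<close>. Then the fit is a constant \<open>c\<close> on the two adjacent blocks of
  \<open>m = \<lfloor>n \<delta>\<^sub>n\<rfloor>\<close> observations on either side of \<open>t\<^sub>k\<^sup>*\<close>. The true levels on these blocks
  differ by a fixed amount, so on one of them \<open>c\<close> misses the true level by more than a
  fixed \<open>d > 0\<close>. On that block, compare the fit with the one obtained by moving \<open>c\<close> to the true
  level plus or minus \<open>d\<close>. Only the two jumps at the ends of the block change, so the penalty grows by
  at most \<open>2 n \<lambda>\<^sub>n\<close> per unit of shift; since the fit is optimal, the loss cannot
  fall by more than that. A subgradient of the convex loss turns this into a statement about counts:
  the number of errors on the block that are below \<open>d\<close> is at most \<open>m \<tau> + 2 n \<lambda>\<^sub>n\<close>, or the number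
  below \<open>- d\<close> is at least \<open>m \<tau> - 2 n \<lambda>\<^sub>n\<close> (lemma \<open>undetected_change_counts\<close>).

  Both are unlikely. As the density is positive and \<open>0\<close> is the \<open>\<tau>\<close>-quantile, the expected
  counts \<open>m F(d)\<close> and \<open>m F(- d)\<close> differ from \<open>m \<tau>\<close> by at least \<open>2 m g\<close> for a fixed \<open>g > 0\<close>, while
  \<open>n \<lambda>\<^sub>n\<close> is of smaller order than \<open>m\<close>. The blocks and the thresholds are not random, so Hoeffding's
  inequality for each of these finitely many counts applies
  (lemma \<open>block_count_concentration\<close>).

  Hence, outside an event of vanishing probability, every true change-point has an estimated one
  within \<open>n \<delta>\<^sub>n\<close>. The true change-points are eventually at least \<open>2 n \<delta>\<^sub>n\<close>
  apart, because their limiting fractions are distinct and \<open>\<delta>\<^sub>n\<close> tends to zero. So the \<open>K\<close> windows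
  are disjoint, and if exactly \<open>K\<close> change-points are estimated, then the \<open>k\<close>-th smallest of
  them lies in the \<open>k\<close>-th window (lemma \<open>matching_by_windows\<close>).
\<close>

section \<open>Shifting a constant block of the fit\<close>

text \<open>
  The right-hand side uses the slope of the loss at the end point \<open>y\<close>, which bounds the
  increment from above by convexity. At the old end point \<open>x\<close> the slope would depend on
  the random level of the fit; with \<open>y\<close>, the sum over a block counts the observations below the new
  level, which can be chosen.
\<close>

lemma quantile_loss_subgradient:
  "quantile_loss \<tau> y - quantile_loss \<tau> x \<le> (\<tau> - indicator {..<0} y) * (y - x)"
  by (auto simp: quantile_loss_def indicator_def algebra_simps)

lemma design_apply_eq_sum:
  assumes "i \<le> n"
  shows "design_apply n \<beta> i = (\<Sum>j = 1..i. \<beta> j)"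
proof -
  have "design_apply n \<beta> i = (\<Sum>j = 1..n. if j \<in> {1..i} then \<beta> j else 0)"
    unfolding design_apply_def design_matrix_def by (intro sum.cong) auto
  also have "\<dots> = (\<Sum>j \<in> {1..n} \<inter> {1..i}. \<beta> j)"
    by (simp only: sum.inter_restrict[OF finite_atLeastAtMost])
  also have "{1..n} \<inter> {1..i} = {1..i}"
    using assms by auto
  finally show ?thesis .
qed

lemma design_apply_constant_block:
  assumes zero: "\<And>j. j \<in> {a<..<b} \<Longrightarrow> \<beta> j = 0"
    and i: "i \<in> {a..<b}" and b: "b \<le> n + 1"
  shows "design_apply n \<beta> i = design_apply n \<beta> a"
proof -
  have "(\<Sum>j = 1..a. \<beta> j) = (\<Sum>j = 1..i. \<beta> j)"
    using i zero by (intro sum.mono_neutral_left) auto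
  then show ?thesis
    using i b by (simp add: design_apply_eq_sum)
qed

text \<open>
  The competitor moves the fit on the block from \<open>c\<close> to \<open>q\<close>. In the coordinates \<open>\<beta>\<close>
  this adds \<open>q - c\<close> at \<open>a\<close> and subtracts it at \<open>b\<close>, which costs at most \<open>2 \<bar>c - q\<bar>\<close> in the
  \<open>\<ell>\<^sub>1\<close> penalty (less when the block touches an end of the sample). As \<open>q\<close> is free on either
  side of \<open>c\<close>, the inequality bounds the residual signs on the block from both sides.
\<close>

lemma qlasso_constant_block:
  fixes \<beta> y :: "nat \<Rightarrow> real" and c q l :: real
  assumes sol: "qlasso_solution \<tau> n l y \<beta>"
    and l: "0 \<le> l" and ab: "1 \<le> a" "a < b" "b \<le> n + 1"
    and const: "\<And>i. i \<in> {a..<b} \<Longrightarrow> design_apply n \<beta> i = c"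
  shows "- (2 * real n * l * \<bar>c - q\<bar>) \<le> (c - q) * (\<Sum>i = a..<b. \<tau> - indicator {..<q} (y i))"
proof -
  define h where "h = q - c"
  define s where "s j = (if j = a then h else 0) - (if j = b then h else 0)" for j :: nat
  define \<beta>' where "\<beta>' j = \<beta> j + s j" for j
  have sum_s: "(\<Sum>j = 1..i. s j) = (if i \<in> {a..<b} then h else 0)" for i
    using ab by (auto simp: s_def sum_subtractf)
  have shifted: "design_apply n \<beta>' i = design_apply n \<beta> i + (if i \<in> {a..<b} then h else 0)"
    if "i \<in> {1..n}" for i
    using that sum_s[of i] by (simp add: design_apply_eq_sum \<beta>'_def sum.distrib)
  let ?loss = "\<lambda>\<beta> i. quantile_loss \<tau> (y i - design_apply n \<beta> i)"
  have "(\<Sum>i = 2..n. \<bar>\<beta>' i\<bar>) \<le> (\<Sum>i = 2..n. \<bar>\<beta> i\<bar> + \<bar>s i\<bar>)"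
    by (intro sum_mono) (simp add: \<beta>'_def abs_triangle_ineq)
  also have "\<dots> = (\<Sum>i = 2..n. \<bar>\<beta> i\<bar>) + (\<Sum>i = 2..n. \<bar>s i\<bar>)"
    by (simp add: sum.distrib)
  also have "(\<Sum>i = 2..n. \<bar>s i\<bar>) \<le> (\<Sum>i \<in> {a, b}. \<bar>s i\<bar>)"
  proof -
    have "(\<Sum>i = 2..n. \<bar>s i\<bar>) = (\<Sum>i \<in> {2..n} \<inter> {a, b}. \<bar>s i\<bar>)"
      by (intro sum.mono_neutral_right) (auto simp: s_def)
    also have "\<dots> \<le> (\<Sum>i \<in> {a, b}. \<bar>s i\<bar>)"
      by (intro sum_mono2) auto
    finally show ?thesis .
  qed
  also have "(\<Sum>i \<in> {a, b}. \<bar>s i\<bar>) = 2 * \<bar>h\<bar>"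
    using ab by (simp add: s_def)
  finally have "(\<Sum>i = 2..n. \<bar>\<beta>' i\<bar>) \<le> (\<Sum>i = 2..n. \<bar>\<beta> i\<bar>) + 2 * \<bar>h\<bar>"
    by simp
  then have penalty: "real n * l * (\<Sum>i = 2..n. \<bar>\<beta>' i\<bar>)
      \<le> real n * l * (\<Sum>i = 2..n. \<bar>\<beta> i\<bar>) + 2 * real n * l * \<bar>h\<bar>"
    using l mult_left_mono[of _ _ "real n * l"] by (fastforce simp: algebra_simps)
  have "qlasso_objective \<tau> n l y \<beta> \<le> qlasso_objective \<tau> n l y \<beta>'"
    using sol unfolding qlasso_solution_def is_arg_min_def by (meson not_less)
  with penalty have "- (2 * real n * l * \<bar>h\<bar>) \<le> (\<Sum>i = 1..n. ?loss \<beta>' i) - (\<Sum>i = 1..n. ?loss \<beta> i)"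
    unfolding qlasso_objective_def by linarith
  also have "\<dots> = (\<Sum>i = 1..n. ?loss \<beta>' i - ?loss \<beta> i)"
    by (simp add: sum_subtractf)
  also have "\<dots> = (\<Sum>i = a..<b. ?loss \<beta>' i - ?loss \<beta> i)"
    using ab by (intro sum.mono_neutral_right) (auto simp: shifted)
  also have "\<dots> \<le> (\<Sum>i = a..<b. (c - q) * (\<tau> - indicator {..<q} (y i)))"
  proof (rule sum_mono)
    fix i assume i: "i \<in> {a..<b}"
    then have "design_apply n \<beta>' i = q" "design_apply n \<beta> i = c"
      using ab const shifted[of i] by (auto simp: h_def)
    then show "?loss \<beta>' i - ?loss \<beta> i \<le> (c - q) * (\<tau> - indicator {..<q} (y i))"
      using quantile_loss_subgradient[of \<tau> "y i - q" "y i - c"]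
      by (simp add: indicator_def mult.commute)
  qed
  finally show ?thesis
    by (simp add: h_def sum_distrib_left abs_minus_commute)
qed

text \<open>
  The comparison level is \<open>\<mu> + d\<close> or \<open>\<mu> - d\<close>, whichever lies strictly between the true level \<open>\<mu>\<close> and
  the fitted level \<open>c\<close>. It does not depend on \<open>c\<close> otherwise, so the count that
  results has a threshold that is not random.
\<close>

lemma misfitted_block_counts:
  fixes e y :: "nat \<Rightarrow> real"
  assumes sol: "qlasso_solution \<tau> n l y \<beta>"
    and l: "0 \<le> l" and ab: "1 \<le> a" "a < b" "b \<le> n + 1"
    and const: "\<And>i. i \<in> {a..<b} \<Longrightarrow> design_apply n \<beta> i = c"
    and y: "\<And>i. i \<in> {a..<b} \<Longrightarrow> y i = \<mu> + e i"
    and far: "d < \<bar>c - \<mu>\<bar>" and d: "0 < d"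
  shows "(\<Sum>i = a..<b. indicator {..<d} (e i)) \<le> real (b - a) * \<tau> + 2 * real n * l
    \<or> real (b - a) * \<tau> - 2 * real n * l \<le> (\<Sum>i = a..<b. indicator {..<-d} (e i))"
proof -
  have shift: "(c - (\<mu> + x)) * (real (b - a) * \<tau> - (\<Sum>i = a..<b. indicator {..<x} (e i)))
      \<ge> - (2 * real n * l * \<bar>c - (\<mu> + x)\<bar>)" for x
  proof -
    have "(\<Sum>i = a..<b. indicator {..<\<mu> + x} (y i)) = (\<Sum>i = a..<b. indicator {..<x} (e i) :: real)"
      by (intro sum.cong) (auto simp: y indicator_def)
    then show ?thesis
      using qlasso_constant_block[OF sol l ab const, of "\<mu> + x"] by (simp add: sum_subtractf)
  qed
  consider "\<mu> + d < c" | "c < \<mu> + - d"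
    using far by linarith
  then show ?thesis
  proof cases
    case 1
    then have "(c - (\<mu> + d)) * (real (b - a) * \<tau> - (\<Sum>i = a..<b. indicator {..<d} (e i)))
        \<ge> (c - (\<mu> + d)) * - (2 * real n * l)"
      using shift[of d] by (simp add: mult.commute)
    then have "- (2 * real n * l) \<le> real (b - a) * \<tau> - (\<Sum>i = a..<b. indicator {..<d} (e i))"
      by (rule mult_le_cancel_left_pos[THEN iffD1, rotated]) (use 1 in simp)
    then show ?thesis by linarith
  next
    case 2
    then have "\<bar>c - (\<mu> + - d)\<bar> = - (c - (\<mu> + - d))"
      by simp
    then have "(c - (\<mu> + - d)) * (real (b - a) * \<tau> - (\<Sum>i = a..<b. indicator {..<-d} (e i)))
        \<ge> (c - (\<mu> + - d)) * (2 * real n * l)"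
      using shift[of "- d"] by (simp only: mult_minus_right minus_minus mult.commute)
    then have "real (b - a) * \<tau> - (\<Sum>i = a..<b. indicator {..<-d} (e i)) \<le> 2 * real n * l"
      by (rule mult_le_cancel_left_neg[THEN iffD1, rotated]) (use 2 in simp)
    then show ?thesis by linarith
  qed
qed

text \<open>
  A constant cannot be within \<open>d\<close> of two levels that are more than \<open>2 d\<close> apart, so one of the two
  blocks is misfitted.
\<close>

lemma undetected_change_counts:
  fixes e y :: "nat \<Rightarrow> real"
  assumes sol: "qlasso_solution \<tau> n l y \<beta>"
    and l: "0 \<le> l" and m: "0 < m" "m < t" "t + m \<le> n + 1"
    and left: "\<And>i. i \<in> {t - m..<t} \<Longrightarrow> y i = \<mu> + e i"
    and right: "\<And>i. i \<in> {t..<t + m} \<Longrightarrow> y i = \<mu>' + e i"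
    and none: "\<And>i. i \<in> {t - m<..<t + m} \<Longrightarrow> \<beta> i = 0"
    and jump: "2 * d < \<bar>\<mu> - \<mu>'\<bar>" and d: "0 < d"
  shows "\<exists>B \<in> {{t - m..<t}, {t..<t + m}}.
    (\<Sum>i \<in> B. indicator {..<d} (e i)) \<le> real m * \<tau> + 2 * real n * l
    \<or> real m * \<tau> - 2 * real n * l \<le> (\<Sum>i \<in> B. indicator {..<-d} (e i))"
proof -
  define c where "c = design_apply n \<beta> (t - m)"
  have const: "design_apply n \<beta> i = c" if "i \<in> {t - m..<t + m}" for i
    unfolding c_def using design_apply_constant_block[of "t - m" "t + m" \<beta> i n] none that m by auto
  consider "d < \<bar>c - \<mu>\<bar>" | "d < \<bar>c - \<mu>'\<bar>"
    using jump by linarith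
  then show ?thesis
  proof cases
    case 1
    then show ?thesis
      using misfitted_block_counts[OF sol l _ _ _ const left, of "t - m" t d] m d by simp
  next
    case 2
    have "design_apply n \<beta> i = c" if "i \<in> {t..<t + m}" for i
      using const that by auto
    with 2 show ?thesis
      using misfitted_block_counts[OF sol l _ _ _ _ right, of t "t + m" c d] m d by simp
  qed
qed

section \<open>Concentration of the error counts\<close>

text \<open>
  Positivity of the density separates \<open>F(d)\<close> and \<open>F(- d)\<close> from \<open>\<tau> = F(0)\<close>; this is what makes
  the counts informative about the level of the fit.
\<close>

lemma measure_lessThan_strict_mono:
  fixes f :: "real \<Rightarrow> real"
  assumes pos: "\<And>x. 0 < f x" and f[measurable]: "f \<in> borel_measurable borel"
    and prob: "prob_space (density lborel (\<lambda>x. ennreal (f x)))" and "x < y"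
  shows "measure (density lborel (\<lambda>x. ennreal (f x))) {..<x}
    < measure (density lborel (\<lambda>x. ennreal (f x))) {..<y}"
proof -
  interpret D: prob_space "density lborel (\<lambda>x. ennreal (f x))" by fact
  have "D.prob {x..<y} \<noteq> 0"
  proof
    assume "D.prob {x..<y} = 0"
    then have "emeasure (density lborel (\<lambda>x. ennreal (f x))) {x..<y} = 0"
      by (simp add: D.emeasure_eq_measure)
    then have "AE z in lborel. z \<in> {x..<y} \<longrightarrow> ennreal (f z) = 0"
      by (subst (asm) emeasure_density) (auto simp: nn_integral_0_iff_AE indicator_def)
    moreover have "ennreal (f z) \<noteq> 0" for z
      using pos[of z] by simp
    ultimately have "AE z in lborel. z \<notin> {x..<y}"
      by simp
    then have "emeasure lborel {x..<y} = 0"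
      by (subst (asm) AE_iff_measurable[of "{x..<y}"]) auto
    then show False using \<open>x < y\<close> by simp
  qed
  then have "0 < D.prob {x..<y}"
    by (simp add: zero_less_measure_iff)
  moreover have "D.prob {..<y} = D.prob {..<x} + D.prob {x..<y}"
    using \<open>x < y\<close> by (subst D.finite_measure_Union[symmetric]) (auto simp: ivl_disj_un)
  ultimately show ?thesis by simp
qed

lemma (in prob_space) block_count_concentration:
  fixes e :: "nat \<Rightarrow> 'a \<Rightarrow> real"
  assumes indep: "indep_vars (\<lambda>_. borel) e B" and B: "finite B" "B \<noteq> {}"
    and p: "\<And>i. i \<in> B \<Longrightarrow> prob {\<omega> \<in> space M. e i \<omega> < x} = p" and g: "0 \<le> g"
  shows "prob {\<omega> \<in> space M. real (card B) * g \<le>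
      \<bar>(\<Sum>i \<in> B. indicator {..<x} (e i \<omega>)) - real (card B) * p\<bar>}
    \<le> 2 * exp (- 2 * real (card B) * g\<^sup>2)"
proof -
  let ?X = "\<lambda>i \<omega>. indicator {..<x} (e i \<omega>) :: real"
  have rv[measurable]: "e i \<in> borel_measurable M" if "i \<in> B" for i
    using indep that by (auto simp: indep_vars_def)
  have indep': "indep_vars (\<lambda>_. borel) ?X B"
    by (rule indep_vars_compose2[OF indep, where Y = "\<lambda>_. indicator {..<x}"]) auto
  have expect: "expectation (?X i) = p" if "i \<in> B" for i
  proof -
    have "expectation (?X i) = expectation (indicator {\<omega> \<in> space M. e i \<omega> < x})"
      by (intro Bochner_Integration.integral_cong) (auto simp: indicator_def)
    also have "\<dots> = p"
      using p[OF that] rv[OF that] by simp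
    finally show ?thesis .
  qed
  interpret Hoeffding_ineq M B ?X "\<lambda>_. 0" "\<lambda>_. 1" "\<Sum>i\<in>B. expectation (?X i)"
    by unfold_locales (use B indep' in \<open>auto simp: indicator_def\<close>)
  have "0 < card B" using B by (simp add: card_gt_0_iff)
  then show ?thesis
    using Hoeffding_ineq_abs_ge[of "real (card B) * g"] g expect
    by (simp add: power2_eq_square mult_ac)
qed

section \<open>Matching the estimated to the true change-points\<close>

text \<open>
  Points chosen from successive windows are strictly increasing, since the windows do not overlap.
  There are \<open>K\<close> of them, so they are all of the estimated change-points, in increasing order.
\<close>

lemma matching_by_windows:
  fixes t :: "nat \<Rightarrow> nat" and r :: real
  assumes card: "card (est_changepoints n \<beta>) = K"
    and gap: "\<And>k. 1 \<le> k \<Longrightarrow> k < K \<Longrightarrow> real (t k) + 2 * r \<le> real (t (k + 1))"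
    and hit: "\<And>k. k \<in> {1..K} \<Longrightarrow> \<exists>a \<in> est_changepoints n \<beta>. \<bar>real a - real (t k)\<bar> < r"
    and k: "k \<in> {1..K}"
  shows "\<bar>real (est_changepoint n \<beta> k) - real (t k)\<bar> < r"
proof -
  let ?A = "est_changepoints n \<beta>"
  obtain a where a: "\<And>k. k \<in> {1..K} \<Longrightarrow> a k \<in> ?A \<and> \<bar>real (a k) - real (t k)\<bar> < r"
    using hit by metis
  have step: "a k < a (Suc k)" if "1 \<le> k" "k < K" for k
    using a[of k] a[of "Suc k"] gap[of k] that by auto
  have mono: "a i < a j" if "1 \<le> i" "i < j" "j \<le> K" for i j
    using that(2,1,3)
  proof (induction rule: strict_inc_induct)
    case (base i)
    then show ?case using step[of i] by simp
  next
    case (step i)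
    then show ?case using \<open>\<And>k. 1 \<le> k \<Longrightarrow> k < K \<Longrightarrow> a k < a (Suc k)\<close>[of i] by fastforce
  qed
  have sorted: "sorted_wrt (<) (map a [1..<K + 1])"
    using mono by (auto simp: sorted_wrt_map sorted_wrt_iff_nth_less simp del: upt_Suc)
  have "finite ?A" by (simp add: est_changepoints_def)
  moreover have "a ` {1..K} \<subseteq> ?A" using a by auto
  moreover have "inj_on a {1..K}"
    using mono by (intro linorder_inj_onI') fastforce
  then have "card (a ` {1..K}) = K"
    by (simp add: card_image)
  ultimately have "a ` {1..K} = ?A"
    using card by (intro card_subset_eq) auto
  then have "set (map a [1..<K + 1]) = ?A"
    by (simp add: atLeastLessThanSuc_atLeastAtMost del: upt_Suc)
  then have "sorted_list_of_set ?A = map a [1..<K + 1]"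
    using sorted \<open>finite ?A\<close>
    by (intro sorted_distinct_set_unique) (auto simp: strict_sorted_iff simp del: upt_Suc)
  then have "est_changepoint n \<beta> k = a k"
    using k by (auto simp: est_changepoint_def simp del: upt_Suc)
  then show ?thesis using a[OF k] by simp
qed

section \<open>Consistency of the estimated change-points\<close>

lemma change_point_windows:
  fixes t :: "nat \<Rightarrow> nat" and r :: real
  assumes ends: "t 0 = 1" "t (K + 1) = n + 1"
    and r: "0 \<le> r" and gap: "\<And>k. k \<le> K \<Longrightarrow> real (t k) + 2 * r \<le> real (t (k + 1))"
    and k: "k \<in> {1..K}"
  shows "1 \<le> t (k - 1)" "t (k - 1) + 2 * nat \<lfloor>r\<rfloor> \<le> t k"
    "t k + 2 * nat \<lfloor>r\<rfloor> \<le> t (k + 1)" "t (k + 1) \<le> n + 1"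
proof -
  have mono: "t i \<le> t j" if "i \<le> j" "j \<le> K + 1" for i j
    using that
  proof (induction j rule: dec_induct)
    case (step j)
    then show ?case using gap[of j] r by fastforce
  qed simp
  show "1 \<le> t (k - 1)" using mono[of 0 "k - 1"] ends k by auto
  show "t (k + 1) \<le> n + 1" using mono[of "k + 1" "K + 1"] ends k by auto
  have floor: "real (nat \<lfloor>r\<rfloor>) \<le> r" using r by simp
  show "t (k - 1) + 2 * nat \<lfloor>r\<rfloor> \<le> t k"
    using gap[of "k - 1"] k floor by fastforce
  show "t k + 2 * nat \<lfloor>r\<rfloor> \<le> t (k + 1)"
    using gap[of k] k floor by fastforce
qed

text \<open>
  This is the deterministic core: the randomness of the sample enters only through
  the two hypotheses on the counts. The blocks have length \<open>\<lfloor>r\<rfloor>\<close>, so that the interior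
  break points of their union are at distance at most \<open>\<lfloor>r\<rfloor> - 1 < r\<close> from \<open>t k\<close>.
\<close>

lemma change_points_located:
  fixes t :: "nat \<Rightarrow> nat" and e y \<mu> :: "nat \<Rightarrow> real" and r :: real
  defines "m \<equiv> nat \<lfloor>r\<rfloor>"
  assumes sol: "qlasso_solution \<tau> n l y \<beta>" and l: "0 \<le> l"
    and card: "card (est_changepoints n \<beta>) = K"
    and ends: "t 0 = 1" "t (K + 1) = n + 1"
    and r: "1 \<le> r" and gap: "\<And>k. k \<le> K \<Longrightarrow> real (t k) + 2 * r \<le> real (t (k + 1))"
    and y: "\<And>k i. k \<in> {1..K + 1} \<Longrightarrow> i \<in> {t (k - 1)..t k - 1} \<Longrightarrow> y i = \<mu> k + e i"
    and jump: "\<And>k. k \<in> {1..K} \<Longrightarrow> 2 * d < \<bar>\<mu> k - \<mu> (k + 1)\<bar>" and d: "0 < d"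
    and upper: "\<And>k B. k \<in> {1..K} \<Longrightarrow> B \<in> {{t k - m..<t k}, {t k..<t k + m}} \<Longrightarrow>
      real m * \<tau> + 2 * real n * l < (\<Sum>i \<in> B. indicator {..<d} (e i))"
    and lower: "\<And>k B. k \<in> {1..K} \<Longrightarrow> B \<in> {{t k - m..<t k}, {t k..<t k + m}} \<Longrightarrow>
      (\<Sum>i \<in> B. indicator {..<-d} (e i)) < real m * \<tau> - 2 * real n * l"
    and k: "k \<in> {1..K}"
  shows "\<bar>real (est_changepoint n \<beta> k) - real (t k)\<bar> < r"
proof (rule matching_by_windows[OF card _ _ k])
  show "real (t k) + 2 * r \<le> real (t (k + 1))" if "1 \<le> k" "k < K" for k
    using gap that by simp
next
  fix k assume k: "k \<in> {1..K}"
  have m: "1 \<le> m" "real m \<le> r" "r < real m + 1"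
    using r by (auto simp: m_def le_nat_iff le_floor_iff of_nat_nat; linarith)+
  have "0 \<le> r" using r by simp
  note windows = change_point_windows[OF ends this gap k, folded m_def]
  show "\<exists>a \<in> est_changepoints n \<beta>. \<bar>real a - real (t k)\<bar> < r"
  proof (rule ccontr)
    assume *: "\<not> ?thesis"
    have zero: "\<beta> i = 0" if "i \<in> {t k - m<..<t k + m}" for i
    proof (rule ccontr)
      assume "\<beta> i \<noteq> 0"
      then have "i \<in> est_changepoints n \<beta>"
        using that windows m by (auto simp: est_changepoints_def)
      moreover have "\<bar>real i - real (t k)\<bar> < r"
        using that m windows by auto
      ultimately show False using * by blast
    qed
    have "\<exists>B \<in> {{t k - m..<t k}, {t k..<t k + m}}.
      (\<Sum>i \<in> B. indicator {..<d} (e i)) \<le> real m * \<tau> + 2 * real n * l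
      \<or> real m * \<tau> - 2 * real n * l \<le> (\<Sum>i \<in> B. indicator {..<-d} (e i))"
    proof (rule undetected_change_counts[OF sol l])
      show "y i = \<mu> k + e i" if "i \<in> {t k - m..<t k}" for i
        using that k windows by (intro y) auto
      show "y i = \<mu> (k + 1) + e i" if "i \<in> {t k..<t k + m}" for i
        using that k windows by (intro y) auto
    qed (use m windows zero jump[OF k] d in auto)
    then show False using upper[OF k] lower[OF k] by (meson not_le)
  qed
qed

theorem theorem3p1:
  fixes \<tau> :: real and K N0 :: nat and C :: real
    and M :: "nat \<Rightarrow> 'a measure"
    and \<epsilon> Y :: "nat \<Rightarrow> nat \<Rightarrow> 'a \<Rightarrow> real"
    and tstar :: "nat \<Rightarrow> nat \<Rightarrow> nat"
    and \<mu> \<tau>star :: "nat \<Rightarrow> real"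
    and f f' :: "real \<Rightarrow> real"
    and lam \<delta> :: "nat \<Rightarrow> real"
    and \<beta>hat :: "nat \<Rightarrow> 'a \<Rightarrow> nat \<Rightarrow> real"
  assumes tau: "0 < \<tau>" "\<tau> < 1"
    and K_pos: "1 \<le> K"
    and prob: "\<And>n. N0 \<le> n \<Longrightarrow> prob_space (M n)"
    and t_conv: "\<And>n. N0 \<le> n \<Longrightarrow> tstar n 0 = 1" "\<And>n. N0 \<le> n \<Longrightarrow> tstar n (K + 1) = n + 1"
    and t_order: "\<And>n. N0 \<le> n \<Longrightarrow> 1 < tstar n 1"
      "\<And>n k. N0 \<le> n \<Longrightarrow> 1 \<le> k \<Longrightarrow> k < K \<Longrightarrow> tstar n k < tstar n (k + 1)"
      "\<And>n. N0 \<le> n \<Longrightarrow> tstar n K < n"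
    and mu_jump: "\<And>k. k \<in> {1..K} \<Longrightarrow> \<mu> k \<noteq> \<mu> (k + 1)"
    and model: "\<And>n k t \<omega>. N0 \<le> n \<Longrightarrow> k \<in> {1..K + 1} \<Longrightarrow> t \<in> {tstar n (k - 1)..tstar n k - 1} \<Longrightarrow>
      \<omega> \<in> space (M n) \<Longrightarrow> Y n t \<omega> = \<mu> k + \<epsilon> n t \<omega>"
    and err_indep: "\<And>n. N0 \<le> n \<Longrightarrow> prob_space.indep_vars (M n) (\<lambda>_. borel) (\<epsilon> n) {1..n}"
    and err_density: "\<And>n i. N0 \<le> n \<Longrightarrow> i \<in> {1..n} \<Longrightarrow> distributed (M n) lborel (\<epsilon> n i) (\<lambda>x. ennreal (f x))"
    and err_quantile: "\<And>n i. N0 \<le> n \<Longrightarrow> i \<in> {1..n} \<Longrightarrow>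
      measure (M n) {\<omega> \<in> space (M n). \<epsilon> n i \<omega> < 0} = \<tau>"
    and f_pos: "\<And>x. 0 < f x"
    and f_C1: "\<And>x. (f has_real_derivative f' x) (at x)" "continuous_on UNIV f'"
    and delta: "decseq \<delta>" "\<And>n. 0 < \<delta> n" "\<delta> \<longlonglongrightarrow> 0"
    and I_min: "\<And>n. N0 \<le> n \<Longrightarrow>
      real n * \<delta> n \<le> Min ((\<lambda>k. real (tstar n (k + 1)) - real (tstar n k)) ` {1..K})"
    and lambda_pos: "\<And>n. N0 \<le> n \<Longrightarrow> 0 < lam n"
    and lambda_delta: "(\<lambda>n. lam n / \<delta> n) \<longlonglongrightarrow> 0"
    and lambda_rate: "0 < C" "\<And>n. N0 \<le> n \<Longrightarrow> lam n = C * sqrt (ln (real n) / real n)"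
    and t_frac: "\<And>k. k \<in> {1..K} \<Longrightarrow> (\<lambda>n. real (tstar n k) / real n) \<longlonglongrightarrow> \<tau>star k"
    and taustar: "0 < \<tau>star 1" "\<And>k. 1 \<le> k \<Longrightarrow> k < K \<Longrightarrow> \<tau>star k < \<tau>star (k + 1)" "\<tau>star K < 1"
    and est_measurable: "\<And>n i. N0 \<le> n \<Longrightarrow> i \<in> {1..n} \<Longrightarrow> (\<lambda>\<omega>. \<beta>hat n \<omega> i) \<in> borel_measurable (M n)"
    and est_solution: "\<And>n \<omega>. N0 \<le> n \<Longrightarrow> \<omega> \<in> space (M n) \<Longrightarrow>
      qlasso_solution \<tau> n (lam n) (\<lambda>t. Y n t \<omega>) (\<beta>hat n \<omega>)"
  shows "(\<lambda>n. measure (M n) {\<omega> \<in> space (M n).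
            card (est_changepoints n (\<beta>hat n \<omega>)) = K \<and>
            real n * \<delta> n \<le>
              Max ((\<lambda>k. \<bar>real (est_changepoint n (\<beta>hat n \<omega>) k) - real (tstar n k)\<bar>) ` {1..K})})
         \<longlonglongrightarrow> 0"
proof -
  let ?D = "density lborel (\<lambda>x. ennreal (f x))"
  define p where "p x = measure ?D {..<x}" for x
  have f_borel: "f \<in> borel_measurable borel"
    using f_C1(1) by (intro borel_measurable_continuous_onI continuous_at_imp_continuous_on)
      (blast intro: DERIV_isCont)
  have p: "measure (M n) {\<omega> \<in> space (M n). \<epsilon> n i \<omega> < x} = p x"
    if "N0 \<le> n" "i \<in> {1..n}" for n i x
  proof -
    have "p x = measure (distr (M n) lborel (\<epsilon> n i)) {..<x}"
      using distributed_distr_eq_density[OF err_density[OF that]] by (simp add: p_def)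
    also have "\<dots> = measure (M n) {\<omega> \<in> space (M n). \<epsilon> n i \<omega> < x}"
      using distributed_measurable[OF err_density[OF that]]
      by (subst measure_distr) (auto intro!: arg_cong[where f = "measure (M n)"])
    finally show ?thesis by simp
  qed
  have p_0: "p 0 = \<tau>"
    using p[of "N0 + 1" 1 0] err_quantile[of "N0 + 1" 1] by simp
  have "prob_space ?D"
    using err_density[of "N0 + 1" 1] prob[of "N0 + 1"]
    by (metis atLeastAtMost_iff distributed_distr_eq_density distributed_measurable le_add1 le_add2
        order_refl prob_space.prob_space_distr)
  then have p_mono: "p x < p x'" if "x < x'" for x x'
    unfolding p_def using measure_lessThan_strict_mono[OF f_pos f_borel _ that] by simp

  obtain d where d: "0 < d" "\<And>k. k \<in> {1..K} \<Longrightarrow> 2 * d < \<bar>\<mu> k - \<mu> (k + 1)\<bar>"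
  proof
    let ?J = "Min ((\<lambda>k. \<bar>\<mu> k - \<mu> (k + 1)\<bar>) ` {1..K})"
    have "0 < ?J" using K_pos mu_jump by (subst Min_gr_iff) auto
    then show "0 < ?J / 3" by simp
    fix k assume "k \<in> {1..K}"
    then have "?J \<le> \<bar>\<mu> k - \<mu> (k + 1)\<bar>" by (intro Min_le) auto
    then show "2 * (?J / 3) < \<bar>\<mu> k - \<mu> (k + 1)\<bar>" using \<open>0 < ?J\<close> by linarith
  qed
  \<comment> \<open>Half of the gap between the expected and the critical proportion is left for the
    random fluctuation and half for the penalty.\<close>
  define g where "g = min (p d - \<tau>) (\<tau> - p (- d)) / 2"
  have g: "0 < g" "\<tau> + 2 * g \<le> p d" "p (- d) \<le> \<tau> - 2 * g"
    using p_mono[of 0 d] p_mono[of "- d" 0] d(1) p_0 by (auto simp: g_def)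

  define r where "r n = real n * \<delta> n" for n
  define m where "m n = nat \<lfloor>r n\<rfloor>" for n
  \<comment> \<open>The blocks grow because \<open>n \<lambda>\<^sub>n\<close> is of order \<open>sqrt (n log n)\<close> and
    \<open>n \<delta>\<^sub>n\<close> is larger still.\<close>
  have lam_at_top: "filterlim (\<lambda>n. real n * lam n) at_top sequentially"
  proof (rule filterlim_cong[THEN iffD2])
    show "filterlim (\<lambda>n. real n * (C * sqrt (ln (real n) / real n))) at_top sequentially"
      using lambda_rate(1) by real_asymp
    show "\<forall>\<^sub>F n in sequentially. real n * lam n = real n * (C * sqrt (ln (real n) / real n))"
      using eventually_ge_at_top[of N0] by eventually_elim (simp add: lambda_rate(2))
  qed auto
  have lam_small: "\<forall>\<^sub>F n in sequentially. real n * lam n < x * r n" if "0 < x" for x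
    using order_tendstoD(2)[OF lambda_delta that] eventually_gt_at_top[of 0]
    by eventually_elim (use delta(2) in \<open>simp add: r_def pos_divide_less_eq\<close>)
  have r_at_top: "filterlim r at_top sequentially"
    by (rule filterlim_at_top_mono[OF lam_at_top])
      (use lam_small[of 1] in \<open>auto elim: eventually_mono\<close>)
  have m_ge: "r n - 1 \<le> real (m n)" for n
    unfolding m_def by linarith
  have m_at_top: "filterlim (\<lambda>n. real (m n)) at_top sequentially"
    by (rule filterlim_at_top_mono[OF filterlim_tendsto_add_at_top[OF tendsto_const[of "- 1"] r_at_top]])
      (use m_ge in \<open>auto simp: algebra_simps\<close>)

  \<comment> \<open>The limiting fractions, extended to the conventional end points \<open>t\<^sub>0\<^sup>* = 1\<close> and
    \<open>t\<^sub>K\<^sub>+\<^sub>1\<^sup>* = n + 1\<close>, so that the first and the last phase need no special treatment.\<close>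
  define s where "s k = (if k = 0 then 0 else if k = K + 1 then 1 else \<tau>star k)" for k
  have s_less: "s k < s (k + 1)" if "k \<le> K" for k
    using that taustar K_pos by (auto simp: s_def)
  have t_lim: "(\<lambda>n. real (tstar n k) / real n) \<longlonglongrightarrow> s k" if "k \<le> K + 1" for k
  proof -
    have "k = 0 \<or> k = K + 1 \<or> k \<in> {1..K}" using that by auto
    then consider "k = 0" | "k = K + 1" | "k \<in> {1..K}" by blast
    then show ?thesis
    proof cases
      case 1
      have "(\<lambda>n. 1 / real n) \<longlonglongrightarrow> 0" by real_asymp
      then show ?thesis
        by (rule tendsto_eq_rhs[OF Lim_transform_eventually])
          (use 1 t_conv(1) in \<open>auto simp: s_def intro!: eventually_mono[OF eventually_ge_at_top[of N0]]\<close>)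
    next
      case 2
      have "(\<lambda>n. real (n + 1) / real n) \<longlonglongrightarrow> 1" by real_asymp
      then show ?thesis
        by (rule tendsto_eq_rhs[OF Lim_transform_eventually])
          (use 2 t_conv(2) in \<open>auto simp: s_def intro!: eventually_mono[OF eventually_ge_at_top[of N0]]\<close>)
    next
      case 3
      then show ?thesis using t_frac by (auto simp: s_def)
    qed
  qed
  have gap: "\<forall>\<^sub>F n in sequentially. \<forall>k \<in> {..K}.
      real (tstar n k) + 2 * r n \<le> real (tstar n (k + 1))"
  proof (rule eventually_ball_finite)
    show "\<forall>k \<in> {..K}. \<forall>\<^sub>F n in sequentially. real (tstar n k) + 2 * r n \<le> real (tstar n (k + 1))"
    proof
      fix k assume "k \<in> {..K}"
      then have "(\<lambda>n. real (tstar n (k + 1)) / real n - (real (tstar n k) / real n + 2 * \<delta> n))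
          \<longlonglongrightarrow> s (k + 1) - (s k + 2 * 0)"
        by (intro tendsto_intros t_lim delta(3)) auto
      moreover have "0 < s (k + 1) - (s k + 2 * 0)"
        using s_less \<open>k \<in> {..K}\<close> by simp
      ultimately have "\<forall>\<^sub>F n in sequentially.
          0 < real (tstar n (k + 1)) / real n - (real (tstar n k) / real n + 2 * \<delta> n)"
        by (rule order_tendstoD(1))
      then show "\<forall>\<^sub>F n in sequentially. real (tstar n k) + 2 * r n \<le> real (tstar n (k + 1))"
        using eventually_gt_at_top[of 0]
        by eventually_elim (simp add: r_def field_simps)
    qed
  qed simp

  define blocks where "blocks n k = {{tstar n k - m n..<tstar n k}, {tstar n k..<tstar n k + m n}}" for n k
  define dev where "dev n B x = {\<omega> \<in> space (M n).
    real (m n) * g \<le> \<bar>(\<Sum>i \<in> B. indicator {..<x} (\<epsilon> n i \<omega>)) - real (m n) * p x\<bar>}" for n B x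
  let ?I = "\<lambda>n. SIGMA k:{1..K}. blocks n k \<times> {d, - d}"
  define bad where "bad n = (\<Union>(k, B, x) \<in> ?I n. dev n B x)" for n
  let ?E = "\<lambda>n. {\<omega> \<in> space (M n).
            card (est_changepoints n (\<beta>hat n \<omega>)) = K \<and>
            real n * \<delta> n \<le>
              Max ((\<lambda>k. \<bar>real (est_changepoint n (\<beta>hat n \<omega>) k) - real (tstar n k)\<bar>) ` {1..K})}"
  have "\<forall>\<^sub>F n in sequentially. measure (M n) (?E n) \<le> real (K * 4) * (2 * exp (- 2 * real (m n) * g\<^sup>2))"
    using eventually_ge_at_top[of N0] gap lam_small[of "g / 4", simplified, OF g(1)]
      filterlim_at_top_dense[THEN iffD1, OF r_at_top, rule_format, of 2]
  proof eventually_elim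
    case (elim n)
    interpret prob_space "M n" by (rule prob) fact
    have m: "0 < m n" "r n \<le> 2 * real (m n)"
      using elim(4) by (auto simp: m_def) linarith+
    \<comment> \<open>Since \<open>n \<delta>\<^sub>n > 2\<close>, rounding down to \<open>m\<close> loses at most half, which is
      why \<open>g / 4\<close> is the right bound for \<open>\<lambda>\<^sub>n / \<delta>\<^sub>n\<close>.\<close>
    have noise: "2 * real n * lam n \<le> real (m n) * g"
    proof -
      have "2 * (real n * lam n) \<le> g * (r n / 2)" using elim(3) by simp
      also have "\<dots> \<le> g * real (m n)" using m(2) g(1) by simp
      finally show ?thesis by (simp add: mult_ac)
    qed
    have gap: "real (tstar n k) + 2 * r n \<le> real (tstar n (k + 1))" if "k \<le> K" for k
      using elim(2) that by simp
    have block: "B \<subseteq> {1..n} \<and> card B = m n" if "k \<in> {1..K}" "B \<in> blocks n k" for k B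
    proof -
      have "0 \<le> r n" using elim(4) by simp
      then show ?thesis
        using change_point_windows[OF t_conv[OF elim(1)] _ gap that(1)] that(2)
        by (auto simp: blocks_def m_def)
    qed
    have eps[measurable]: "\<epsilon> n i \<in> borel_measurable (M n)" if "i \<in> {1..n}" for i
      using distributed_measurable[OF err_density[OF elim(1) that]] by simp
    have dev_sets: "dev n B x \<in> sets (M n)" if "B \<subseteq> {1..n}" for B x
    proof -
      have [measurable]: "\<epsilon> n i \<in> borel_measurable (M n)" if "i \<in> B" for i
        using that \<open>B \<subseteq> {1..n}\<close> by auto
      show ?thesis unfolding dev_def by measurable
    qed
    have dev_prob: "prob (dev n B x) \<le> 2 * exp (- 2 * real (m n) * g\<^sup>2)"
      if "B \<subseteq> {1..n}" "card B = m n" for B x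
    proof -
      have "finite B" "B \<noteq> {}" using that m(1) by (auto intro: finite_subset)
      then show ?thesis
        using block_count_concentration[of "\<epsilon> n" B x "p x" g] p[OF elim(1)] that g(1)
          indep_vars_subset[OF err_indep[OF elim(1)]] by (auto simp: dev_def subset_eq)
    qed
    have fin: "finite (?I n)" by (auto simp: blocks_def)
    have "?E n \<subseteq> bad n"
    proof
      fix \<omega> assume \<omega>: "\<omega> \<in> ?E n"
      show "\<omega> \<in> bad n"
      proof (rule ccontr)
        assume not_bad: "\<omega> \<notin> bad n"
        have close: "\<bar>(\<Sum>i \<in> B. indicator {..<x} (\<epsilon> n i \<omega>)) - real (m n) * p x\<bar> < real (m n) * g"
          if "k \<in> {1..K}" "B \<in> blocks n k" "x \<in> {d, - d}" for k B x
        proof (rule ccontr)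
          assume "\<not> ?thesis"
          then have "\<omega> \<in> dev n B x" using \<omega> by (simp add: dev_def)
          then show False using that not_bad unfolding bad_def by blast
        qed
        have scaled: "real (m n) * \<tau> + 2 * (real (m n) * g) \<le> real (m n) * p d"
          "real (m n) * p (- d) \<le> real (m n) * \<tau> - 2 * (real (m n) * g)"
          using mult_left_mono[OF g(2), of "real (m n)"] mult_left_mono[OF g(3), of "real (m n)"]
          by (simp_all add: algebra_simps)
        have "\<bar>real (est_changepoint n (\<beta>hat n \<omega>) k) - real (tstar n k)\<bar> < r n"
          if "k \<in> {1..K}" for k
        proof (rule change_points_located[where e = "\<lambda>i. \<epsilon> n i \<omega>" and K = K and \<mu> = \<mu> and d = d])
          show "qlasso_solution \<tau> n (lam n) (\<lambda>i. Y n i \<omega>) (\<beta>hat n \<omega>)"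
            "card (est_changepoints n (\<beta>hat n \<omega>)) = K"
            using est_solution[OF elim(1)] \<omega> by auto
          show "Y n i \<omega> = \<mu> k + \<epsilon> n i \<omega>"
            if "k \<in> {1..K + 1}" "i \<in> {tstar n (k - 1)..tstar n k - 1}" for k i
            using model[OF elim(1) that] \<omega> by simp
          show "0 \<le> lam n" using lambda_pos[OF elim(1)] by simp
          show "1 \<le> r n" using elim(4) by simp
        next
          fix k B assume B: "k \<in> {1..K}"
            "B \<in> {{tstar n k - nat \<lfloor>r n\<rfloor>..<tstar n k}, {tstar n k..<tstar n k + nat \<lfloor>r n\<rfloor>}}"
          then have "B \<in> blocks n k" by (simp add: blocks_def m_def)
          then show "real (nat \<lfloor>r n\<rfloor>) * \<tau> + 2 * real n * lam n < (\<Sum>i \<in> B. indicator {..<d} (\<epsilon> n i \<omega>))"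
            "(\<Sum>i \<in> B. indicator {..<- d} (\<epsilon> n i \<omega>)) < real (nat \<lfloor>r n\<rfloor>) * \<tau> - 2 * real n * lam n"
            using close[OF B(1), of B d] close[OF B(1), of B "- d"] scaled noise
            unfolding m_def by (auto simp: abs_less_iff)
        qed (fact t_conv[OF elim(1)] gap d that)+
        then have "Max ((\<lambda>k. \<bar>real (est_changepoint n (\<beta>hat n \<omega>) k) - real (tstar n k)\<bar>) ` {1..K}) < r n"
          using K_pos by (subst Max_less_iff) auto
        then show False using \<omega> by (simp add: r_def)
      qed
    qed
    moreover have "bad n \<in> sets (M n)"
      unfolding bad_def using fin dev_sets block by (intro sets.finite_UN) auto
    ultimately have "prob (?E n) \<le> prob (bad n)" by (rule finite_measure_mono)
    also have "\<dots> \<le> (\<Sum>(k, B, x) \<in> ?I n. prob (dev n B x))"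
      unfolding bad_def case_prod_unfold
      by (rule measure_UNION_le) (use fin dev_sets block in auto)
    also have "\<dots> \<le> real (card (?I n)) * (2 * exp (- 2 * real (m n) * g\<^sup>2))"
      using dev_prob block by (intro sum_bounded_above) auto
    \<comment> \<open>Two blocks and two thresholds for each change-point.\<close>
    also have "\<dots> \<le> real (K * 4) * (2 * exp (- 2 * real (m n) * g\<^sup>2))"
    proof -
      have four: "card (blocks n k \<times> {d, - d}) \<le> 2 * 2" for k
        unfolding card_cartesian_product blocks_def by (intro mult_mono) (simp_all add: card_insert_if)
      have "card (?I n) = (\<Sum>k = 1..K. card (blocks n k \<times> {d, - d}))"
        by (rule card_SigmaI) (auto simp: blocks_def)
      also have "\<dots> \<le> (\<Sum>k = 1..K. 2 * 2)"
        using four by (rule sum_mono)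
      finally have "card (?I n) \<le> K * 4" by simp
      then show ?thesis by (intro mult_right_mono of_nat_mono) simp_all
    qed
    finally show ?case .
  qed
  moreover have "(\<lambda>n. real (K * 4) * (2 * exp (- 2 * real (m n) * g\<^sup>2))) \<longlonglongrightarrow> real (K * 4) * (2 * 0)"
  proof (intro tendsto_intros filterlim_compose[OF exp_at_bot])
    have "filterlim (\<lambda>x. - 2 * x * g\<^sup>2) at_bot at_top"
      using g(1) by real_asymp
    then show "filterlim (\<lambda>n. - 2 * real (m n) * g\<^sup>2) at_bot sequentially"
      using m_at_top by (rule filterlim_compose)
  qed
  then have "(\<lambda>n. real (K * 4) * (2 * exp (- 2 * real (m n) * g\<^sup>2))) \<longlonglongrightarrow> 0"
    by simp
  ultimately show ?thesis
    by (intro tendsto_sandwich[OF always_eventually[OF allI[OF measure_nonneg]] _ tendsto_const])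
qed

end
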